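(* Let $c:\mathbb{R}\times\mathbb{R}\to\mathbb{R}$, $x_0\in\mathbb{R}$, and let $S_0=\{y\in\mathbb{R}:c_x(x_0,y)=A(y)\}$ for some affine map $A:\mathbb{R}\to\mathbb{R}$, such that $x_0\in\mathrm{ri}\,\mathrm{conv}\,S_0$. (i) If $y\mapsto c_x(x_0,y)$ is strictly convex or strictly concave, then $|S_0|\le 2$. (ii) If for every $y_0\in\mathbb{R}$ there is an integer $k(y_0)\ge 2$ such that $y\mapsto c_x(x_0,y)$ is $k(y_0)$ times differentiable at $y_0$ and $c_{xy^{k(y_0)}}(x_0,y_0)\ne 0$, then $S_0$ is discrete. If furthermore $c_x(x_0,\cdot)$ is super-linear in $y$, then $S_0$ is finite.
   Context: $c_x$ is the partial derivative of $c$ in the first variable, assumed to exist at $(x_0,y)$ for all $y$; $c_{xy^k}(x_0,y_0)$ is the $k$-th derivative of $y\mapsto c_x(x_0,y)$ at $y_0$. $\mathrm{ri}\,\mathrm{conv}$ is the relative interior of the convex hull. A set is discrete if it consists of isolated points. A function $f$ is super-linear if $\lim_{|y|\to\infty}|f(y)|/|y|=\infty$. $|S_0|$ is the cardinality of $S_0$. *)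

theory Defs
  imports "HOL-Analysis.Analysis"
begin

definition partial_x :: "(real \<times> real \<Rightarrow> real) \<Rightarrow> real \<Rightarrow> real \<Rightarrow> real" where
  "partial_x c x y = deriv (\<lambda>t. c (t, y)) x"

definition affine_map :: "(real \<Rightarrow> real) \<Rightarrow> bool" where
  "affine_map A \<longleftrightarrow> (\<exists>L b. linear L \<and> (\<forall>y. A y = L y + b))"

definition strictly_convex_on :: "'a::real_vector set \<Rightarrow> ('a \<Rightarrow> real) \<Rightarrow> bool" where
  "strictly_convex_on S f \<longleftrightarrow> convex S \<and>
     (\<forall>x\<in>S. \<forall>y\<in>S. \<forall>u>0. \<forall>v>0. x \<noteq> y \<longrightarrow> u + v = 1 \<longrightarrow>
        f (u *\<^sub>R x + v *\<^sub>R y) < u * f x + v * f y)"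

definition strictly_concave_on :: "'a::real_vector set \<Rightarrow> ('a \<Rightarrow> real) \<Rightarrow> bool" where
  "strictly_concave_on S f \<longleftrightarrow> strictly_convex_on S (\<lambda>x. - f x)"

text \<open>
  Pointwise \<open>k\<close>-fold differentiability: differentiability of the \<open>k\<close>-th derivative at a point
  requires that derivative to exist on a neighbourhood of the point, whence the filter condition.
  No continuity of the highest derivative is required. The value of the \<open>k\<close>-th derivative
  is \<open>(deriv ^^ k) f y\<close>, which is meaningful only under this predicate since \<open>deriv\<close> is total.
\<close>

fun times_differentiable_at :: "nat \<Rightarrow> (real \<Rightarrow> real) \<Rightarrow> real \<Rightarrow> bool" where
  "times_differentiable_at 0 f y \<longleftrightarrow> True"
| "times_differentiable_at (Suc k) f y \<longleftrightarrow>
     (\<forall>\<^sub>F z in nhds y. times_differentiable_at k f z) \<and> (deriv ^^ k) f differentiable (at y)"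

definition super_linear :: "(real \<Rightarrow> real) \<Rightarrow> bool" where
  "super_linear f \<longleftrightarrow> filterlim (\<lambda>y. \<bar>f y\<bar> / \<bar>y\<bar>) at_top at_infinity"

end

(* For (ii): if the graph of a function meets a line at points accumulating at y, the mean value
   theorem makes its derivative equal to the slope at points accumulating at y. Applied repeatedly
   to f = c_x(x0, -), this makes every derivative of order at least 2 that exists at y vanish there,
   so under the nondegeneracy condition S0 has no limit point in the real line at all.
   Super-linearity confines S0 to a bounded set. *)
theory Submission
  imports Defs
begin

lemma affine_map_real_iff:
  "affine_map A \<longleftrightarrow> (\<exists>m b. \<forall>y. A y = m * y + b)"
proof
  assume "affine_map A"
  then obtain L b where L: "linear L" "\<And>y. A y = L y + b"
    unfolding affine_map_def by blast
  have "L y = L 1 * y" for y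
    using linear_scale[OF L(1), of y 1] by (simp add: mult.commute)
  with L(2) show "\<exists>m b. \<forall>y. A y = m * y + b" by metis
next
  assume "\<exists>m b. \<forall>y. A y = m * y + b"
  then obtain m b where "\<And>y. A y = m * y + b" by blast
  moreover have "linear ((*) m)"
    by (simp add: linear_times)
  ultimately show "affine_map A"
    unfolding affine_map_def by blast
qed

lemma strictly_convex_on_minus_affine:
  fixes f :: "real \<Rightarrow> real"
  assumes "strictly_convex_on S f"
  shows "strictly_convex_on S (\<lambda>y. f y - (m * y + b))"
  unfolding strictly_convex_on_def
proof (intro conjI ballI allI impI)
  show "convex S" using assms unfolding strictly_convex_on_def by blast
next
  fix x y u v :: real
  assume "x \<in> S" "y \<in> S" "u > 0" "v > 0" "x \<noteq> y" "u + v = 1"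
  then have "f (u *\<^sub>R x + v *\<^sub>R y) < u * f x + v * f y"
    using assms unfolding strictly_convex_on_def by blast
  moreover have "u * (m * x + b) + v * (m * y + b) = m * (u * x + v * y) + (u + v) * b"
    by (simp add: algebra_simps)
  ultimately show "f (u *\<^sub>R x + v *\<^sub>R y) - (m * (u *\<^sub>R x + v *\<^sub>R y) + b)
      < u * (f x - (m * x + b)) + v * (f y - (m * y + b))"
    using \<open>u + v = 1\<close> by (simp add: right_diff_distrib)
qed

text \<open>The middle point is a proper convex combination of \<open>p\<close> and
  \<open>r\<close>, and the chord over \<open>[p, r]\<close> is identically zero.\<close>

lemma strictly_convex_on_zero_between:
  fixes g :: "real \<Rightarrow> real"
  assumes "strictly_convex_on UNIV g" "p < q" "q < r" "g p = 0" "g r = 0"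
  shows "g q < 0"
proof -
  define u where "u = (r - q) / (r - p)"
  define v where "v = (q - p) / (r - p)"
  have "u > 0" "v > 0" "u + v = 1" "u * p + v * r = q"
    using assms(2,3) unfolding u_def v_def by (auto simp: divide_simps) (auto simp: algebra_simps)
  moreover from this have "g (u *\<^sub>R p + v *\<^sub>R r) < u * g p + v * g r"
    using assms(1-3) unfolding strictly_convex_on_def by fastforce
  ultimately show ?thesis using assms(4,5) by simp
qed

lemma card_le_2_if_no_three:
  fixes S :: "'a::linorder set"
  assumes "\<And>p q r. p \<in> S \<Longrightarrow> q \<in> S \<Longrightarrow> r \<in> S \<Longrightarrow> p < q \<Longrightarrow> q < r \<Longrightarrow> False"
  shows "finite S \<and> card S \<le> 2"
proof (rule ccontr)
  assume "\<not> ?thesis"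
  then obtain T where T: "T \<subseteq> S" "card T = 3"
    by (metis One_nat_def Suc_1 infinite_arbitrarily_large not_less_eq_eq numeral_3_eq_3 obtain_subset_with_card_n)
  then obtain x y z where "T = {x, y, z}" "x \<noteq> y" "x \<noteq> z" "y \<noteq> z"
    by (auto simp: card_3_iff)
  with T(1) assms show False
    by (metis insert_subset linorder_neqE)
qed

text \<open>Subtracting the line preserves strict convexity and turns intersections into zeros; of
  three ordered zeros, the middle one would have to be negative.\<close>

lemma strictly_convex_on_eq_affine_card_le_2:
  fixes f :: "real \<Rightarrow> real"
  assumes "strictly_convex_on UNIV f"
  shows "finite {y. f y = m * y + b} \<and> card {y. f y = m * y + b} \<le> 2"
  using strictly_convex_on_zero_between[OF strictly_convex_on_minus_affine[OF assms, of m b]]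
  by (intro card_le_2_if_no_three) (force simp: algebra_simps)

text \<open>Both limits are computed along the intersection set, where they are unique because
  \<open>y\<close> is a limit point. Differentiability at \<open>y\<close> alone suffices.\<close>

lemma islimpt_eq_affine_deriv:
  fixes h :: "real \<Rightarrow> real"
  assumes "h differentiable (at y)" and lim: "y islimpt {z. h z = m * z + b}"
  shows "h y = m * y + b" and "deriv h y = m"
proof -
  let ?S = "{z. h z = m * z + b}"
  have nt: "at y within ?S \<noteq> bot"
    using lim by (simp add: trivial_limit_within)
  have D: "(h has_real_derivative deriv h y) (at y)"
    using assms(1) by (simp add: DERIV_deriv_iff_real_differentiable)
  then have "(h \<longlongrightarrow> h y) (at y within ?S)"
    using DERIV_continuous continuous_within has_field_derivative_at_within by blast
  moreover have "((\<lambda>z. m * z + b) \<longlongrightarrow> m * y + b) (at y within ?S)"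
    by (intro tendsto_intros)
  then have "(h \<longlongrightarrow> m * y + b) (at y within ?S)"
    by (rule Lim_transform_eventually) (simp add: eventually_at_filter)
  ultimately show eq: "h y = m * y + b"
    using nt tendsto_unique by blast
  have "((\<lambda>z. (h z - h y) / (z - y)) \<longlongrightarrow> deriv h y) (at y within ?S)"
    using has_field_derivative_at_within[OF D] by (simp add: has_field_derivative_iff)
  \<comment> \<open>Now that \<open>y\<close> is known to lie on the line too, the difference
    quotient is constantly \<open>m\<close> on the set away from \<open>y\<close>.\<close>
  moreover have "((\<lambda>z. (h z - h y) / (z - y)) \<longlongrightarrow> m) (at y within ?S)"
    by (rule Lim_transform_eventually[OF tendsto_const])
      (auto simp: eventually_at_filter eq divide_simps algebra_simps)
  ultimately show "deriv h y = m"
    using nt tendsto_unique by blast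
qed

text \<open>The point \<open>y\<close> is itself on the line, so each nearby intersection point
  spans with \<open>y\<close> a chord of slope \<open>m\<close>, to which the mean value theorem
  applies.\<close>

lemma islimpt_deriv_eq_slope:
  fixes h :: "real \<Rightarrow> real"
  assumes "\<forall>\<^sub>F z in nhds y. h differentiable (at z)" and "y islimpt {z. h z = m * z + b}"
  shows "y islimpt {z. deriv h z = m}"
  unfolding islimpt_approachable
proof (intro allI impI)
  fix e :: real
  assume "e > 0"
  obtain d where "d > 0" and d: "\<And>z. dist z y < d \<Longrightarrow> h differentiable (at z)"
    using assms(1) unfolding eventually_nhds_metric by blast
  have hy: "h y = m * y + b"
    using d[of y] \<open>d > 0\<close> assms(2) by (intro islimpt_eq_affine_deriv(1)) auto
  \<comment> \<open>The bound \<open>d\<close> keeps the whole segment from \<open>y\<close> to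
    \<open>z\<close> where \<open>h\<close> is differentiable; \<open>e\<close> makes the
    intermediate point close enough to \<open>y\<close>.\<close>
  obtain z where z: "h z = m * z + b" "z \<noteq> y" "dist z y < min d e"
    using assms(2)[unfolded islimpt_approachable, rule_format, of "min d e"] \<open>d > 0\<close> \<open>e > 0\<close>
    by auto
  \<comment> \<open>The point \<open>z\<close> may lie on either side of \<open>y\<close>, so the
    endpoints are sorted first.\<close>
  define p where "p = min y z"
  define q where "q = max y z"
  have pq: "p < q" "h q - h p = (q - p) * m"
    using z hy unfolding p_def q_def min_def max_def by (auto simp: algebra_simps)
  have "(h has_real_derivative deriv h x) (at x)" if "p \<le> x" "x \<le> q" for x
  proof -
    have "dist x y < d"
      using that z(3) unfolding p_def q_def dist_real_def by (auto simp: min_def max_def split: if_splits)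
    then show ?thesis
      using d by (simp add: DERIV_deriv_iff_real_differentiable)
  qed
  from MVT2[OF pq(1) this] obtain \<xi> where \<xi>: "p < \<xi>" "\<xi> < q" "h q - h p = (q - p) * deriv h \<xi>"
    by blast
  have "\<xi> \<noteq> y" "dist \<xi> y < e"
    using \<xi>(1,2) z(3) unfolding p_def q_def dist_real_def by (auto simp: min_def max_def split: if_splits)
  moreover have "deriv h \<xi> = m"
    using \<xi>(3) pq by simp
  ultimately show "\<exists>x'\<in>{z. deriv h z = m}. x' \<noteq> y \<and> dist x' y < e"
    by blast
qed

text \<open>The top order is the second conjunct of the recursion; lower orders follow by evaluating
  the filter condition at \<open>y\<close> itself.\<close>

lemma times_differentiable_at_imp_differentiable:
  "times_differentiable_at k f y \<Longrightarrow> j < k \<Longrightarrow> (deriv ^^ j) f differentiable (at y)"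
proof (induction k arbitrary: y)
  case (Suc k)
  then show ?case
    using eventually_nhds_x_imp_x by (cases "j = k") fastforce+
qed simp

lemma islimpt_eq_affine_iterated_deriv:
  fixes f :: "real \<Rightarrow> real"
  assumes diff: "times_differentiable_at k f y" and "k \<ge> 2"
    and lim: "y islimpt {z. f z = m * z + b}"
  shows "(deriv ^^ k) f y = 0"
proof -
  \<comment> \<open>Derivatives of order up to \<open>n = k - 2\<close> are differentiable on a
    neighbourhood of \<open>y\<close>, but the one of order \<open>n + 1\<close> possibly only at
    \<open>y\<close>.\<close>
  obtain n where k: "k = Suc (Suc n)"
    using \<open>k \<ge> 2\<close> less_iff_Suc_add[of 1 k] by auto
  have near: "\<forall>\<^sub>F z in nhds y. (deriv ^^ j) f differentiable (at z)" if "j \<le> n" for j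
  proof -
    have "\<forall>\<^sub>F z in nhds y. times_differentiable_at (Suc n) f z"
      using diff unfolding k times_differentiable_at.simps(2)[of "Suc n"] by blast
    then show ?thesis
      by (rule eventually_mono) (use that in \<open>simp only: times_differentiable_at_imp_differentiable less_Suc_eq_le\<close>)
  qed
  \<comment> \<open>The level \<open>l\<close> is the slope \<open>m\<close> for
    \<open>j = 0\<close> and 0 afterwards; a constant level counts as a line of slope 0 in the next
    round.\<close>
  have "\<exists>l. y islimpt {z. (deriv ^^ Suc j) f z = l}" if "j \<le> n" for j
    using that
  proof (induction j)
    case 0
    then show ?case
      using islimpt_deriv_eq_slope[OF _ lim] near[of 0] by auto
  next
    case (Suc j)
    then obtain l where "y islimpt {z. (deriv ^^ Suc j) f z = 0 * z + l}"
      by auto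
    from islimpt_deriv_eq_slope[OF near[OF Suc.prems] this] show ?case
      by auto
  qed
  then obtain l where "y islimpt {z. (deriv ^^ Suc n) f z = 0 * z + l}"
    by auto
  moreover have "(deriv ^^ Suc n) f differentiable (at y)"
    using times_differentiable_at_imp_differentiable[OF diff, of "Suc n"] by (simp add: k)
  \<comment> \<open>The last differentiation uses the pointwise lemma instead of the mean value
    theorem, since no neighbourhood is available at this order.\<close>
  ultimately have "deriv ((deriv ^^ Suc n) f) y = 0"
    by (intro islimpt_eq_affine_deriv(2))
  then show ?thesis by (simp add: k)
qed

text \<open>On the line, the ratio of \<open>\<bar>f y\<bar>\<close> to \<open>\<bar>y\<bar>\<close>
  is at most \<open>\<bar>m\<bar> + \<bar>b\<bar>\<close> once \<open>\<bar>y\<bar>\<close> is at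
  least 1, whereas super-linearity makes it larger far out.\<close>

lemma super_linear_eq_affine_bounded:
  assumes "super_linear f"
  shows "bounded {y. f y = m * y + b}"
proof -
  have "\<forall>\<^sub>F y in at_infinity. \<bar>f y\<bar> / \<bar>y\<bar> > \<bar>m\<bar> + \<bar>b\<bar>"
    using assms unfolding super_linear_def filterlim_at_top_dense by blast
  then obtain R where R: "\<And>y. \<bar>y\<bar> \<ge> R \<Longrightarrow> \<bar>f y\<bar> / \<bar>y\<bar> > \<bar>m\<bar> + \<bar>b\<bar>"
    unfolding eventually_at_infinity by auto
  have "\<bar>y\<bar> \<le> max R 1" if y: "f y = m * y + b" for y
  proof (rule ccontr)
    assume "\<not> ?thesis"
    then have big: "\<bar>y\<bar> \<ge> R" "\<bar>y\<bar> \<ge> 1" by auto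
    have "(\<bar>m\<bar> + \<bar>b\<bar>) * \<bar>y\<bar> < \<bar>f y\<bar>"
      using R[OF big(1)] big(2) by (simp add: pos_less_divide_eq)
    also have "\<bar>f y\<bar> \<le> \<bar>m\<bar> * \<bar>y\<bar> + \<bar>b\<bar> * 1"
      unfolding y using abs_triangle_ineq[of "m * y" b] by (simp add: abs_mult)
    also have "\<dots> \<le> \<bar>m\<bar> * \<bar>y\<bar> + \<bar>b\<bar> * \<bar>y\<bar>"
      using big(2) by (intro add_left_mono mult_left_mono) auto
    finally show False by (simp add: algebra_simps)
  qed
  then show ?thesis
    unfolding bounded_iff by (intro exI[of _ "max R 1"]) simp
qed

theorem theorem2p11:
  fixes c :: "real \<times> real \<Rightarrow> real" and x0 :: real and A :: "real \<Rightarrow> real" and S0 :: "real set"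
  assumes "\<And>y. (\<lambda>x. c (x, y)) differentiable (at x0)"
    and "affine_map A"
    and "S0 = {y. partial_x c x0 y = A y}"
    and "x0 \<in> rel_interior (convex hull S0)"
  shows "(strictly_convex_on UNIV (partial_x c x0) \<or> strictly_concave_on UNIV (partial_x c x0)
            \<longrightarrow> finite S0 \<and> card S0 \<le> 2)
       \<and> ((\<forall>y0. \<exists>k\<ge>2. times_differentiable_at k (partial_x c x0) y0 \<and>
                        (deriv ^^ k) (partial_x c x0) y0 \<noteq> 0)
            \<longrightarrow> discrete S0 \<and> (super_linear (partial_x c x0) \<longrightarrow> finite S0))"
proof -
  define f where "f = partial_x c x0"
  obtain m b where "\<And>y. A y = m * y + b"
    using assms(2) unfolding affine_map_real_iff by blast
  then have S0: "S0 = {y. f y = m * y + b}"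
    by (simp add: assms(3) f_def)
  have "finite S0 \<and> card S0 \<le> 2" if "strictly_convex_on UNIV f \<or> strictly_concave_on UNIV f"
    using that
  proof
    assume "strictly_convex_on UNIV f"
    then show ?thesis
      unfolding S0 by (rule strictly_convex_on_eq_affine_card_le_2)
  next
    assume "strictly_concave_on UNIV f"
    then have "strictly_convex_on UNIV (\<lambda>y. - f y)"
      by (simp add: strictly_concave_on_def)
    \<comment> \<open>Negating both the function and the line leaves the intersection set unchanged
      and reduces to the convex case.\<close>
    moreover have "S0 = {y. - f y = (- m) * y + (- b)}"
      unfolding S0 by auto
    ultimately show ?thesis
      using strictly_convex_on_eq_affine_card_le_2 by metis
  qed
  moreover have "discrete S0 \<and> (super_linear f \<longrightarrow> finite S0)"
    if nondeg: "\<forall>y0. \<exists>k\<ge>2. times_differentiable_at k f y0 \<and> (deriv ^^ k) f y0 \<noteq> 0"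
  proof -
    have nolim: "\<not> y islimpt S0" for y
      using nondeg islimpt_eq_affine_iterated_deriv unfolding S0 by blast
    then have "discrete S0"
      by (simp add: discrete_def isolated_in_islimpt_iff)
    moreover have "finite S0" if "super_linear f"
    proof -
      have "bounded S0"
        unfolding S0 by (rule super_linear_eq_affine_bounded[OF that])
      \<comment> \<open>By Bolzano-Weierstrass an infinite bounded set has a limit point, possibly
        outside \<open>S0\<close>; hence \<open>nolim\<close> ranges over all reals.\<close>
      then show ?thesis
        using bounded_infinite_imp_islimpt nolim by blast
    qed
    ultimately show ?thesis by blast
  qed
  ultimately show ?thesis
    unfolding f_def by blast
qed

end
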